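(* Let $k\in\mathbb{N}$, let $F=(f_1,\dots,f_m)$ be a sequence of $k$-relabeling functions, and let $\mathsf{D}$ be a coherent DP-core with identity cleaning equipped with a witness action. If there is an $F$-relabeled $(k,\mathsf{D})$-refutation, then there exists a $k$-instructive tree decomposition $\tau\in\mathcal{T}_k$ such that $G(\tau)\notin\mathcal{P}(\mathsf{D})$.
   Context: Graphs. A graph is a triple $G=(V,E,\rho)$ with $V,E$ finite subsets of $\mathbb{N}$ and $\rho\subseteq E\times V$ such that each edge is incident to exactly two distinct vertices (parallel edges allowed). A graph property is a set of graphs closed under isomorphism. Instructive decompositions. The $k$-instructive alphabet consists of $\mathtt{Leaf}$ (arity 0), $\mathtt{IntroVertex}_u$, $\mathtt{ForgetVertex}_u$ ($u\in[k+1]$), $\mathtt{IntroEdge}_{u,v}$ (distinct $u,v\in[k+1]$) of arity 1, and $\mathtt{Join}$ (arity 2). $\mathcal{T}_k$ is the set of terms legal with respect to bags: $\mathtt{Leaf}$ has bag $\emptyset$; $\mathtt{IntroVertex}_u(\sigma)$ requires $u\notin$ bag$(\sigma)$ and adds $u$; $\mathtt{ForgetVertex}_u(\sigma)$ requires $u\in$ bag$(\sigma)$ and removes $u$; $\mathtt{IntroEdge}_{u,v}(\sigma)$ requires $u,v\in$ bag$(\sigma)$; $\mathtt{Join}(\sigma_1,\sigma_2)$ requires equal child bags. Each $\tau\in\mathcal{T}_k$ defines a graph $G(\tau)$ and top bag $B(\tau)$: $\mathtt{Leaf}$ is the empty graph; $\mathtt{IntroVertex}_u$ adds a fresh isolated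 vertex labeled $u$; $\mathtt{ForgetVertex}_u$ removes label $u$; $\mathtt{IntroEdge}_{u,v}$ adds a new edge between the vertices labeled $u,v$; $\mathtt{Join}$ takes the disjoint union of the child graphs identifying, for each bag label, the two vertices carrying it (edges never identified). DP-cores. A DP-core $\mathsf{D}$ assigns to each $k$ a tuple $\mathsf{D}[k]$: a decidable set $\mathcal{W}_k\subseteq\{0,1\}^*$ of witnesses, $\mathtt{Final}_k:\mathcal{W}_k\to\{0,1\}$, a finite set $\mathtt{Leaf}_k\subseteq\mathcal{W}_k$, functions $\mathtt{IntroVertex}_u,\mathtt{ForgetVertex}_u,\mathtt{IntroEdge}_{u,v}:\mathcal{W}_k\to$ finite subsets of $\mathcal{W}_k$, $\mathtt{Join}:\mathcal{W}_k^2\to$ finite subsets, and a cleaning function $\mathtt{Clean}_k$ on finite subsets; transitions are lifted to finite sets by union. The dynamization $\mathrm{Dyn}_k(\tau)$ is $\mathtt{Leaf}_k$ at leaves and otherwise $\mathtt{Clean}_k$ applied to the lifted transition of the children's dynamizations. $\mathsf{D}[k]$ accepts $\tau$ if $\mathrm{Dyn}_k(\tau)$ contains a final witness ($\mathtt{Final}_k(w)=1$). $\mathcal{P}(\mathsf{D})=\bigcup_k$ (isomorphism closure of $\{G(\tau):\tau\in\mathcal{T}_k$ accepted by $\mathsf{D}[k]\}$). Identity cleaning: each $\mathtt{Clean}_k$ is the identity. Coherent: for $\tau\in\mathcal{T}_k$, $\tau'\in\mathcal{T}_{k'}$ with $G(\tau)\cong G(\tau')$, $\mathsf{D}[k]$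 accepts $\tau$ iff $\mathsf{D}[k']$ accepts $\tau'$. Labels, relabelings, witness actions. Each $w\in\mathcal{W}_k$ has a label set $\mathrm{Lbl}_k(w)\subseteq[k+1]$, $\mathrm{Lbl}_k(S)=\bigcup_{w\in S}\mathrm{Lbl}_k(w)$. A $(k,\mathsf{D})$-state $(b,S)$ ($b\subseteq[k+1]$, $S\subseteq\mathcal{W}_k$ finite) is well-formed if $\mathrm{Lbl}_k(S)\subseteq b$, inconsistent if $S$ has no final witness; the initial state is $(\emptyset,\mathtt{Leaf}_k)$. A $k$-relabeling function is an injective $f:b\to[k+1]$ with $b\subseteq[k+1]$; $\mathcal{F}_k$ is the set of these; $f^{-1}$ is the inverse on the image and $f\circ g$ the partial composition. A witness action for $\mathsf{D}[k]$ is a partial map $\rho(f,w)\in\mathcal{W}_k$ defined exactly when $\mathrm{Lbl}_k(w)\subseteq\mathrm{dom}(f)$ (extended pointwise to sets) such that, whenever defined: finality is preserved; $\mathrm{Lbl}_k(\rho(f,w))=f(\mathrm{Lbl}_k(w))$; $\rho(f^{-1},\rho(f,w))=w$; $\rho(f\circ f',w)=\rho(f,\rho(f',w))$; $\rho(f',w)=\rho(f,w)$ when $f'$ extends $f$; and $\rho$ commutes with transitions: $\rho(f,\mathtt{IntroVertex}_u(w))=\mathtt{IntroVertex}_{f(u)}(\rho(f,w))$, likewise for $\mathtt{ForgetVertex}_u$, $\rho(f,\mathtt{IntroEdge}_{u,v}(w))=\mathtt{IntroEdge}_{f(u),f(v)}(\rho(f,w))$, $\rho(f,\mathtt{Join}(w,w'))=\mathtt{Join}(\rho(f,w),\rho(f,w'))$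 (for labels in $\mathrm{dom}(f)$). Being equipped with a witness action means such a $\rho^k$ is fixed for each $k$. Relabeled refutation. For $F=(f_1,\dots,f_m)$, an $F$-relabeled $(k,\mathsf{D})$-refutation is a sequence of states $(b_0,S_0),\dots,(b_m,S_m)$ with $(b_0,S_0)$ initial, $(b_m,S_m)$ inconsistent, all states well-formed, and for each $i\in[m]$ some $j<i$ with $(b_i,S_i)$ equal to one of $(f_i(b_j\cup\{u\}),\rho(f_i,\mathtt{IntroVertex}_u(S_j)))$ ($u\notin b_j$), $(f_i(b_j\setminus\{u\}),\rho(f_i,\mathtt{ForgetVertex}_u(S_j)))$ ($u\in b_j$), $(f_i(b_j),\rho(f_i,\mathtt{IntroEdge}_{u,v}(S_j)))$ (distinct $u,v\in b_j$), or $(f_i(b_j),\rho(f_i,\mathtt{Join}(S_j,\rho(\pi,S_l))))$ ($l<i$, $b_l=b_j$, $\pi$ a permutation of $b_j$), where in each case $\mathrm{dom}(f_i)$ is exactly the bag to which $f_i$ is applied. *)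

theory Defs
  imports Main "HOL-Library.Nat_Bijection"
begin

section \<open>Partial maps\<close>

definition map_image :: "('a \<rightharpoonup> 'b) \<Rightarrow> 'a set \<Rightarrow> 'b set" where
  "map_image f A = {y. \<exists>x\<in>A. f x = Some y}"

definition map_inv :: "('a \<rightharpoonup> 'b) \<Rightarrow> ('b \<rightharpoonup> 'a)" where
  "map_inv f = (\<lambda>y. if y \<in> ran f then Some (THE x. f x = Some y) else None)"


section \<open>Graphs\<close>

record graph =
  verts :: "nat set"
  edges :: "nat set"
  inc :: "(nat \<times> nat) set"  \<comment> \<open>pairs (edge, vertex)\<close>

definition wf_graph :: "graph \<Rightarrow> bool" where
  "wf_graph G \<longleftrightarrow> finite (verts G) \<and> finite (edges G) \<and> inc G \<subseteq> edges G \<times> verts G \<and>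
     (\<forall>e\<in>edges G. card {v. (e, v) \<in> inc G} = 2)"

definition graph_iso :: "graph \<Rightarrow> graph \<Rightarrow> bool" where
  "graph_iso G H \<longleftrightarrow> (\<exists>\<phi> \<psi>. bij_betw \<phi> (verts G) (verts H) \<and> bij_betw \<psi> (edges G) (edges H) \<and>
     (\<forall>e\<in>edges G. \<forall>v\<in>verts G. (e, v) \<in> inc G \<longleftrightarrow> (\<psi> e, \<phi> v) \<in> inc H))"


section \<open>Instructive tree decompositions\<close>

abbreviation labels :: "nat \<Rightarrow> nat set" where
  "labels k \<equiv> {1..k + 1}"

datatype itd =
    Leaf
  | IntroVertex nat itd
  | ForgetVertex nat itd
  | IntroEdge nat nat itd
  | Join itd itd

fun bag :: "itd \<Rightarrow> nat set" where
  "bag Leaf = {}"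
| "bag (IntroVertex u \<sigma>) = insert u (bag \<sigma>)"
| "bag (ForgetVertex u \<sigma>) = bag \<sigma> - {u}"
| "bag (IntroEdge u v \<sigma>) = bag \<sigma>"
| "bag (Join \<sigma>1 \<sigma>2) = bag \<sigma>1"

fun legal :: "nat \<Rightarrow> itd \<Rightarrow> bool" where
  "legal k Leaf \<longleftrightarrow> True"
| "legal k (IntroVertex u \<sigma>) \<longleftrightarrow> legal k \<sigma> \<and> u \<in> labels k \<and> u \<notin> bag \<sigma>"
| "legal k (ForgetVertex u \<sigma>) \<longleftrightarrow> legal k \<sigma> \<and> u \<in> labels k \<and> u \<in> bag \<sigma>"
| "legal k (IntroEdge u v \<sigma>) \<longleftrightarrow>
     legal k \<sigma> \<and> u \<in> labels k \<and> v \<in> labels k \<and> u \<noteq> v \<and> u \<in> bag \<sigma> \<and> v \<in> bag \<sigma>"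
| "legal k (Join \<sigma>1 \<sigma>2) \<longleftrightarrow> legal k \<sigma>1 \<and> legal k \<sigma>2 \<and> bag \<sigma>1 = bag \<sigma>2"

definition itds :: "nat \<Rightarrow> itd set" where
  "itds k = {\<tau>. legal k \<tau>}"

definition fresh :: "nat set \<Rightarrow> nat" where
  "fresh X = (LEAST n. n \<notin> X)"

text \<open>The second component of a labelled graph sends each label of the top bag to the vertex
  carrying it.\<close>

type_synonym labelled_graph = "graph \<times> (nat \<rightharpoonup> nat)"

definition add_vertex :: "nat \<Rightarrow> labelled_graph \<Rightarrow> labelled_graph" where
  "add_vertex u = (\<lambda>(G, \<theta>). let x = fresh (verts G) in
     (G\<lparr>verts := insert x (verts G)\<rparr>, \<theta>(u \<mapsto> x)))"

definition drop_label :: "nat \<Rightarrow> labelled_graph \<Rightarrow> labelled_graph" where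
  "drop_label u = (\<lambda>(G, \<theta>). (G, \<theta>(u := None)))"

definition add_edge :: "nat \<Rightarrow> nat \<Rightarrow> labelled_graph \<Rightarrow> labelled_graph" where
  "add_edge u v = (\<lambda>(G, \<theta>). let e = fresh (edges G) in
     (G\<lparr>edges := insert e (edges G),
        inc := inc G \<union> {(e, the (\<theta> u)), (e, the (\<theta> v))}\<rparr>, \<theta>))"

text \<open>The disjoint union places the first graph on the even and the second graph on the odd
  numbers, except that a vertex of the second graph carrying a label is sent to the image of the
  vertex of the first graph with the same label.\<close>

definition glue :: "(nat \<rightharpoonup> nat) \<Rightarrow> (nat \<rightharpoonup> nat) \<Rightarrow> nat \<Rightarrow> nat" where
  "glue \<theta>1 \<theta>2 v = (case (\<theta>1 \<circ>\<^sub>m map_inv \<theta>2) v of Some v1 \<Rightarrow> 2 * v1 | None \<Rightarrow> 2 * v + 1)"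

definition join_graphs :: "labelled_graph \<Rightarrow> labelled_graph \<Rightarrow> labelled_graph" where
  "join_graphs = (\<lambda>(G1, \<theta>1) (G2, \<theta>2).
     (\<lparr>verts = (\<lambda>v. 2 * v) ` verts G1 \<union> glue \<theta>1 \<theta>2 ` verts G2,
       edges = (\<lambda>e. 2 * e) ` edges G1 \<union> (\<lambda>e. 2 * e + 1) ` edges G2,
       inc = (\<lambda>(e, v). (2 * e, 2 * v)) ` inc G1 \<union>
             (\<lambda>(e, v). (2 * e + 1, glue \<theta>1 \<theta>2 v)) ` inc G2\<rparr>,
      \<lambda>u. map_option (\<lambda>v. 2 * v) (\<theta>1 u)))"

fun itd_labelled_graph :: "itd \<Rightarrow> labelled_graph" where
  "itd_labelled_graph Leaf = (\<lparr>verts = {}, edges = {}, inc = {}\<rparr>, Map.empty)"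
| "itd_labelled_graph (IntroVertex u \<sigma>) = add_vertex u (itd_labelled_graph \<sigma>)"
| "itd_labelled_graph (ForgetVertex u \<sigma>) = drop_label u (itd_labelled_graph \<sigma>)"
| "itd_labelled_graph (IntroEdge u v \<sigma>) = add_edge u v (itd_labelled_graph \<sigma>)"
| "itd_labelled_graph (Join \<sigma>1 \<sigma>2) =
     join_graphs (itd_labelled_graph \<sigma>1) (itd_labelled_graph \<sigma>2)"

definition itd_graph :: "itd \<Rightarrow> graph" where
  "itd_graph \<tau> = fst (itd_labelled_graph \<tau>)"


section \<open>Decidable sets of words\<close>

text \<open>Decidability is taken with respect to Kleene's partial recursive functions.\<close>

datatype recf = Zero | Succ | Proj nat | Comp recf "recf list" | PrimRec recf recf | Mu recf

inductive computes :: "recf \<Rightarrow> nat list \<Rightarrow> nat \<Rightarrow> bool" where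
  "computes Zero xs 0"
| "computes Succ [x] (Suc x)"
| "i < length xs \<Longrightarrow> computes (Proj i) xs (xs ! i)"
| "list_all2 (\<lambda>g y. computes g xs y) gs ys \<Longrightarrow> computes f ys z \<Longrightarrow> computes (Comp f gs) xs z"
| "computes f xs y \<Longrightarrow> computes (PrimRec f g) (0 # xs) y"
| "computes (PrimRec f g) (n # xs) y \<Longrightarrow> computes g (n # y # xs) z \<Longrightarrow>
     computes (PrimRec f g) (Suc n # xs) z"
| "computes f (n # xs) 0 \<Longrightarrow> (\<forall>i<n. \<exists>y. computes f (i # xs) (Suc y)) \<Longrightarrow>
     computes (Mu f) xs n"

definition decidable :: "bool list set \<Rightarrow> bool" where
  "decidable W \<longleftrightarrow>
     (\<exists>f. \<forall>w. computes f [list_encode (map of_bool w)] (if w \<in> W then 1 else 0))"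


section \<open>DP-cores\<close>

type_synonym witness = "bool list"

record dp_level =
  wits :: "witness set"
  final :: "witness \<Rightarrow> bool"
  leaf_wits :: "witness set"
  intro_vertex :: "nat \<Rightarrow> witness \<Rightarrow> witness set"
  forget_vertex :: "nat \<Rightarrow> witness \<Rightarrow> witness set"
  intro_edge :: "nat \<Rightarrow> nat \<Rightarrow> witness \<Rightarrow> witness set"
  join_wits :: "witness \<Rightarrow> witness \<Rightarrow> witness set"
  clean :: "witness set \<Rightarrow> witness set"

definition fin_subsets :: "dp_level \<Rightarrow> witness set set" where
  "fin_subsets L = {S. S \<subseteq> wits L \<and> finite S}"

definition wf_dp_level :: "nat \<Rightarrow> dp_level \<Rightarrow> bool" where
  "wf_dp_level k L \<longleftrightarrow>
     decidable (wits L) \<and>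
     leaf_wits L \<in> fin_subsets L \<and>
     (\<forall>u\<in>labels k. \<forall>w\<in>wits L. intro_vertex L u w \<in> fin_subsets L) \<and>
     (\<forall>u\<in>labels k. \<forall>w\<in>wits L. forget_vertex L u w \<in> fin_subsets L) \<and>
     (\<forall>u\<in>labels k. \<forall>v\<in>labels k. u \<noteq> v \<longrightarrow> (\<forall>w\<in>wits L. intro_edge L u v w \<in> fin_subsets L)) \<and>
     (\<forall>w\<in>wits L. \<forall>w'\<in>wits L. join_wits L w w' \<in> fin_subsets L) \<and>
     (\<forall>S\<in>fin_subsets L. clean L S \<in> fin_subsets L)"

definition dp_core :: "(nat \<Rightarrow> dp_level) \<Rightarrow> bool" where
  "dp_core D \<longleftrightarrow> (\<forall>k. wf_dp_level k (D k))"

definition lift_transition :: "(witness \<Rightarrow> witness set) \<Rightarrow> witness set \<Rightarrow> witness set" where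
  "lift_transition t S = (\<Union>w\<in>S. t w)"

definition lift_transition2 ::
    "(witness \<Rightarrow> witness \<Rightarrow> witness set) \<Rightarrow> witness set \<Rightarrow> witness set \<Rightarrow> witness set" where
  "lift_transition2 t S S' = (\<Union>w\<in>S. \<Union>w'\<in>S'. t w w')"

fun dyn :: "dp_level \<Rightarrow> itd \<Rightarrow> witness set" where
  "dyn L Leaf = leaf_wits L"
| "dyn L (IntroVertex u \<sigma>) = clean L (lift_transition (intro_vertex L u) (dyn L \<sigma>))"
| "dyn L (ForgetVertex u \<sigma>) = clean L (lift_transition (forget_vertex L u) (dyn L \<sigma>))"
| "dyn L (IntroEdge u v \<sigma>) = clean L (lift_transition (intro_edge L u v) (dyn L \<sigma>))"
| "dyn L (Join \<sigma>1 \<sigma>2) = clean L (lift_transition2 (join_wits L) (dyn L \<sigma>1) (dyn L \<sigma>2))"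

definition accepts :: "dp_level \<Rightarrow> itd \<Rightarrow> bool" where
  "accepts L \<tau> \<longleftrightarrow> (\<exists>w\<in>dyn L \<tau>. final L w)"

definition graph_property :: "(nat \<Rightarrow> dp_level) \<Rightarrow> graph set" where
  "graph_property D =
     (\<Union>k. {G. wf_graph G \<and> (\<exists>\<tau>\<in>itds k. accepts (D k) \<tau> \<and> graph_iso (itd_graph \<tau>) G)})"

definition identity_cleaning :: "(nat \<Rightarrow> dp_level) \<Rightarrow> bool" where
  "identity_cleaning D \<longleftrightarrow> (\<forall>k. \<forall>S\<in>fin_subsets (D k). clean (D k) S = S)"

definition coherent :: "(nat \<Rightarrow> dp_level) \<Rightarrow> bool" where
  "coherent D \<longleftrightarrow> (\<forall>k k'. \<forall>\<tau>\<in>itds k. \<forall>\<tau>'\<in>itds k'.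
     graph_iso (itd_graph \<tau>) (itd_graph \<tau>') \<longrightarrow> (accepts (D k) \<tau> \<longleftrightarrow> accepts (D k') \<tau>'))"


section \<open>Labels, relabelings and witness actions\<close>

definition witness_labelling :: "(nat \<Rightarrow> dp_level) \<Rightarrow> (nat \<Rightarrow> witness \<Rightarrow> nat set) \<Rightarrow> bool" where
  "witness_labelling D Lbl \<longleftrightarrow> (\<forall>k. \<forall>w\<in>wits (D k). Lbl k w \<subseteq> labels k)"

definition relabelings :: "nat \<Rightarrow> (nat \<rightharpoonup> nat) set" where
  "relabelings k = {f. dom f \<subseteq> labels k \<and> ran f \<subseteq> labels k \<and> inj_on f (dom f)}"

type_synonym action = "(nat \<rightharpoonup> nat) \<Rightarrow> witness \<rightharpoonup> witness"

definition act_set :: "action \<Rightarrow> (nat \<rightharpoonup> nat) \<Rightarrow> witness set \<rightharpoonup> witness set" where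
  "act_set \<rho> f S = (if S \<subseteq> dom (\<rho> f) then Some (map_image (\<rho> f) S) else None)"

text \<open>Equations between partial expressions are required whenever both sides are defined.\<close>

definition witness_action ::
    "nat \<Rightarrow> dp_level \<Rightarrow> (witness \<Rightarrow> nat set) \<Rightarrow> action \<Rightarrow> bool" where
  "witness_action k L lbl \<rho> \<longleftrightarrow>
     (\<forall>f\<in>relabelings k. \<forall>w\<in>wits L. w \<in> dom (\<rho> f) \<longleftrightarrow> lbl w \<subseteq> dom f) \<and>
     (\<forall>f\<in>relabelings k. \<forall>w\<in>wits L. \<forall>w'. \<rho> f w = Some w' \<longrightarrow>
        w' \<in> wits L \<and> (final L w' \<longleftrightarrow> final L w) \<and> lbl w' = map_image f (lbl w) \<and>
        \<rho> (map_inv f) w' = Some w) \<and>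
     (\<forall>f\<in>relabelings k. \<forall>f'\<in>relabelings k. \<forall>w\<in>wits L. \<forall>w' w''.
        \<rho> f' w = Some w' \<and> \<rho> f w' = Some w'' \<longrightarrow> \<rho> (f \<circ>\<^sub>m f') w = Some w'') \<and>
     (\<forall>f\<in>relabelings k. \<forall>f'\<in>relabelings k. \<forall>w\<in>wits L. \<forall>w'.
        f \<subseteq>\<^sub>m f' \<and> \<rho> f w = Some w' \<longrightarrow> \<rho> f' w = Some w') \<and>
     (\<forall>f\<in>relabelings k. \<forall>w\<in>wits L. \<forall>w' T u u'.
        f u = Some u' \<and> \<rho> f w = Some w' \<and> act_set \<rho> f (intro_vertex L u w) = Some T \<longrightarrow>
        T = intro_vertex L u' w') \<and>
     (\<forall>f\<in>relabelings k. \<forall>w\<in>wits L. \<forall>w' T u u'.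
        f u = Some u' \<and> \<rho> f w = Some w' \<and> act_set \<rho> f (forget_vertex L u w) = Some T \<longrightarrow>
        T = forget_vertex L u' w') \<and>
     (\<forall>f\<in>relabelings k. \<forall>w\<in>wits L. \<forall>w' T u v u' v'.
        u \<noteq> v \<and> f u = Some u' \<and> f v = Some v' \<and> \<rho> f w = Some w' \<and>
        act_set \<rho> f (intro_edge L u v w) = Some T \<longrightarrow>
        T = intro_edge L u' v' w') \<and>
     (\<forall>f\<in>relabelings k. \<forall>w1\<in>wits L. \<forall>w2\<in>wits L. \<forall>w1' w2' T.
        \<rho> f w1 = Some w1' \<and> \<rho> f w2 = Some w2' \<and> act_set \<rho> f (join_wits L w1 w2) = Some T \<longrightarrow>
        T = join_wits L w1' w2')"


section \<open>Relabeled refutations\<close>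

type_synonym state = "nat set \<times> witness set"

definition is_state :: "nat \<Rightarrow> dp_level \<Rightarrow> state \<Rightarrow> bool" where
  "is_state k L = (\<lambda>(b, S). b \<subseteq> labels k \<and> S \<in> fin_subsets L)"

definition well_formed :: "(witness \<Rightarrow> nat set) \<Rightarrow> state \<Rightarrow> bool" where
  "well_formed lbl = (\<lambda>(b, S). (\<Union>w\<in>S. lbl w) \<subseteq> b)"

definition inconsistent :: "dp_level \<Rightarrow> state \<Rightarrow> bool" where
  "inconsistent L = (\<lambda>(b, S). \<not> (\<exists>w\<in>S. final L w))"

definition initial_state :: "dp_level \<Rightarrow> state" where
  "initial_state L = ({}, leaf_wits L)"

definition relabels_to :: "action \<Rightarrow> (nat \<rightharpoonup> nat) \<Rightarrow> state \<Rightarrow> state \<Rightarrow> bool" where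
  "relabels_to \<rho> f = (\<lambda>(b, S) (b', S').
     dom f = b \<and> b' = map_image f b \<and> act_set \<rho> f S = Some S')"

inductive refutation_step ::
    "nat \<Rightarrow> dp_level \<Rightarrow> action \<Rightarrow> state set \<Rightarrow> (nat \<rightharpoonup> nat) \<Rightarrow> state \<Rightarrow> bool"
  for k L \<rho> Prev f where
  step_intro_vertex:
    "(b, S) \<in> Prev \<Longrightarrow> u \<in> labels k \<Longrightarrow> u \<notin> b \<Longrightarrow>
     relabels_to \<rho> f (b \<union> {u}, lift_transition (intro_vertex L u) S) s \<Longrightarrow>
     refutation_step k L \<rho> Prev f s"
| step_forget_vertex:
    "(b, S) \<in> Prev \<Longrightarrow> u \<in> b \<Longrightarrow>
     relabels_to \<rho> f (b - {u}, lift_transition (forget_vertex L u) S) s \<Longrightarrow>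
     refutation_step k L \<rho> Prev f s"
| step_intro_edge:
    "(b, S) \<in> Prev \<Longrightarrow> u \<in> b \<Longrightarrow> v \<in> b \<Longrightarrow> u \<noteq> v \<Longrightarrow>
     relabels_to \<rho> f (b, lift_transition (intro_edge L u v) S) s \<Longrightarrow>
     refutation_step k L \<rho> Prev f s"
| step_join:
    "(b, S) \<in> Prev \<Longrightarrow> (b, S') \<in> Prev \<Longrightarrow>
     \<pi> \<in> relabelings k \<Longrightarrow> dom \<pi> = b \<Longrightarrow> ran \<pi> = b \<Longrightarrow>
     act_set \<rho> \<pi> S' = Some S'' \<Longrightarrow>
     relabels_to \<rho> f (b, lift_transition2 (join_wits L) S S'') s \<Longrightarrow>
     refutation_step k L \<rho> Prev f s"

text \<open>The lists \<open>F\<close> and \<open>ss\<close> enumerate the relabelings with indices 1 to m and the states with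
  indices 0 to m, so the i-th relabeling is \<open>F ! (i - 1)\<close>.\<close>

definition relabeled_refutation ::
    "nat \<Rightarrow> dp_level \<Rightarrow> (witness \<Rightarrow> nat set) \<Rightarrow> action \<Rightarrow> (nat \<rightharpoonup> nat) list \<Rightarrow> state list \<Rightarrow> bool" where
  "relabeled_refutation k L lbl \<rho> F ss \<longleftrightarrow>
     length ss = length F + 1 \<and>
     (\<forall>s\<in>set ss. is_state k L s \<and> well_formed lbl s) \<and>
     ss ! 0 = initial_state L \<and>
     inconsistent L (ss ! length F) \<and>
     (\<forall>i\<in>{1..length F}.
        refutation_step k L \<rho> {ss ! j | j. j < i} (F ! (i - 1)) (ss ! i))"

end

theory Submission
  imports Defs "HOL-Combinatorics.Permutations"
begin

text \<open>
  A state is reachable if it arises from the initial state by transitions alone, without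
  relabelings; with identity cleaning, the reachable states are the pairs \<open>(B(\<tau>), Dyn(\<tau>))\<close>.
  Every relabeling extends to a permutation \<open>p\<close> of \<open>[k + 1]\<close>. The action of \<open>p\<close> is defined on all
  witnesses, commutes with the transitions, and fixes the leaf witnesses because they carry no
  labels. So reachable states are closed under permutations of the labels, hence under
  relabelings, and all states of a relabeled refutation are reachable. A term \<open>\<tau>\<close> that realizes
  the last, inconsistent state is rejected, and coherence puts \<open>G(\<tau>)\<close> outside the property.
\<close>

lemma map_image_eq_image:
  assumes "\<And>x. x \<in> A \<Longrightarrow> f x = Some (g x)"
  shows "map_image f A = g ` A"
  using assms by (force simp: map_image_def)

lemma map_image_dom: "map_image f (dom f) = ran f"
  by (auto simp: map_image_def ran_def)

lemma act_set_eq_image: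
  assumes "\<And>w. w \<in> S \<Longrightarrow> \<rho> f w = Some (g w)"
  shows "act_set \<rho> f S = Some (g ` S)"
proof -
  have "S \<subseteq> dom (\<rho> f)"
    using assms by blast
  then show ?thesis
    using map_image_eq_image[of S "\<rho> f" g] assms by (simp add: act_set_def)
qed

lemma image_lift_transition:
  assumes "\<And>w. w \<in> S \<Longrightarrow> h ` t w = t' (h w)"
  shows "h ` lift_transition t S = lift_transition t' (h ` S)"
  using assms by (simp add: lift_transition_def image_UN)

lemma image_lift_transition2:
  assumes "\<And>w w'. w \<in> S \<Longrightarrow> w' \<in> S' \<Longrightarrow> h ` t w w' = t' (h w) (h w')"
  shows "h ` lift_transition2 t S S' = lift_transition2 t' (h ` S) (h ` S')"
  using assms by (simp add: lift_transition2_def image_UN)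

lemma fin_subsetsD:
  assumes "S \<in> fin_subsets L" and "w \<in> S"
  shows "w \<in> wits L"
  using assms by (auto simp: fin_subsets_def)

lemma lift_transition_in_fin_subsets:
  assumes "S \<in> fin_subsets L" and "\<And>w. w \<in> wits L \<Longrightarrow> t w \<in> fin_subsets L"
  shows "lift_transition t S \<in> fin_subsets L"
  using assms by (auto simp: lift_transition_def fin_subsets_def subset_iff)

lemma lift_transition2_in_fin_subsets:
  assumes "S \<in> fin_subsets L" and "S' \<in> fin_subsets L"
    and "\<And>w w'. w \<in> wits L \<Longrightarrow> w' \<in> wits L \<Longrightarrow> t w w' \<in> fin_subsets L"
  shows "lift_transition2 t S S' \<in> fin_subsets L"
  using assms by (auto simp: lift_transition2_def fin_subsets_def subset_iff)

lemma inj_on_extends_to_permutation: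
  assumes "finite A" and "B \<subseteq> A" and "inj_on f B" and "f ` B \<subseteq> A"
  obtains p where "p permutes A" and "\<And>x. x \<in> B \<Longrightarrow> p x = f x"
proof -
  have "card (A - B) = card (A - f ` B)"
    using assms by (simp add: card_Diff_subset finite_subset card_image)
  then obtain g where g: "bij_betw g (A - B) (A - f ` B)"
    using finite_same_card_bij assms(1) by blast
  define p where "p x = (if x \<in> B then f x else if x \<in> A then g x else x)" for x
  have "bij_betw p B (f ` B)"
    using assms(3) by (simp add: p_def bij_betw_def inj_on_def)
  moreover have "bij_betw p (A - B) (A - f ` B)"
    using g by (subst bij_betw_cong[of _ p g]) (simp_all add: p_def)
  ultimately have "bij_betw p (B \<union> (A - B)) (f ` B \<union> (A - f ` B))"
    by (rule bij_betw_combine) blast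
  then have "bij_betw p A A"
    using assms(2,4) by (simp add: Un_absorb1)
  then have "p permutes A"
    using assms(2) by (intro bij_imp_permutes) (auto simp: p_def)
  then show thesis
    by (rule that) (simp add: p_def)
qed

definition map_on :: "'a set \<Rightarrow> ('a \<Rightarrow> 'b) \<Rightarrow> 'a \<rightharpoonup> 'b" where
  "map_on A p = (Some \<circ> p) |` A"

lemma map_on_apply: "x \<in> A \<Longrightarrow> map_on A p x = Some (p x)"
  by (simp add: map_on_def)

lemma dom_map_on: "dom (map_on A p) = A"
  by (auto simp: map_on_def)

lemma ran_map_on: "ran (map_on A p) = p ` A"
  using map_image_dom[of "map_on A p"] map_image_eq_image[of A "map_on A p" p]
  by (simp add: dom_map_on map_on_apply)

lemma inj_on_map_on: "inj_on p A \<Longrightarrow> inj_on (map_on A p) A"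
  by (simp add: inj_on_def map_on_apply)

lemma partial_injection_extends_to_permutation:
  assumes "finite A" and "dom f \<subseteq> A" and "ran f \<subseteq> A" and "inj_on f (dom f)"
  obtains p where "p permutes A" and "f \<subseteq>\<^sub>m map_on A p"
proof -
  have "inj_on (the \<circ> f) (dom f)"
    by (intro comp_inj_on assms(4)) (auto simp: inj_on_def)
  moreover have "map_image f (dom f) = (the \<circ> f) ` dom f"
    by (rule map_image_eq_image) auto
  then have "(the \<circ> f) ` dom f \<subseteq> A"
    using assms(3) by (simp only: map_image_dom)
  ultimately obtain p where "p permutes A" and p: "\<And>x. x \<in> dom f \<Longrightarrow> p x = (the \<circ> f) x"
    by (rule inj_on_extends_to_permutation[OF assms(1,2)]) (rule that)
  moreover have "f \<subseteq>\<^sub>m map_on A p"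
    unfolding map_le_def
  proof
    fix x
    assume x: "x \<in> dom f"
    then have "map_on A p x = Some (p x)"
      using assms(2) by (simp add: map_on_apply subsetD)
    then show "f x = map_on A p x"
      using p[OF x] x by auto
  qed
  ultimately show thesis
    by (intro that)
qed

abbreviation relabeling_of :: "nat \<Rightarrow> (nat \<Rightarrow> nat) \<Rightarrow> nat \<rightharpoonup> nat" where
  "relabeling_of k p \<equiv> map_on (labels k) p"

lemma relabeling_of_in_relabelings:
  assumes "p permutes labels k"
  shows "relabeling_of k p \<in> relabelings k"
  unfolding relabelings_def mem_Collect_eq dom_map_on ran_map_on permutes_image[OF assms]
  by (intro conjI order_refl inj_on_map_on permutes_inj_on[OF assms])

lemma relabeling_extends_to_permutation:
  assumes "f \<in> relabelings k"
  obtains p where "p permutes labels k" and "f \<subseteq>\<^sub>m relabeling_of k p"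
proof (rule partial_injection_extends_to_permutation)
  show "finite (labels k)"
    by simp
  show "dom f \<subseteq> labels k" "ran f \<subseteq> labels k" "inj_on f (dom f)"
    using assms by (auto simp: relabelings_def)
qed (rule that)

inductive reachable :: "nat \<Rightarrow> dp_level \<Rightarrow> state \<Rightarrow> bool" for k L where
  initial: "reachable k L ({}, leaf_wits L)"
| intro_vertex: "reachable k L (b, S) \<Longrightarrow> u \<in> labels k \<Longrightarrow> u \<notin> b \<Longrightarrow>
    reachable k L (b \<union> {u}, lift_transition (intro_vertex L u) S)"
| forget_vertex: "reachable k L (b, S) \<Longrightarrow> u \<in> b \<Longrightarrow>
    reachable k L (b - {u}, lift_transition (forget_vertex L u) S)"
| intro_edge: "reachable k L (b, S) \<Longrightarrow> u \<in> b \<Longrightarrow> v \<in> b \<Longrightarrow> u \<noteq> v \<Longrightarrow>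
    reachable k L (b, lift_transition (intro_edge L u v) S)"
| join: "reachable k L (b, S) \<Longrightarrow> reachable k L (b, S') \<Longrightarrow>
    reachable k L (b, lift_transition2 (join_wits L) S S')"

lemmas reachable_induct = reachable.induct[split_format (complete),
  consumes 1, case_names initial intro_vertex forget_vertex intro_edge join]

locale dp_core_level =
  fixes k :: nat and L :: dp_level
  assumes wf_level: "wf_dp_level k L"
begin

lemma leaf_wits_in_fin_subsets: "leaf_wits L \<in> fin_subsets L"
  and intro_vertex_in_fin_subsets:
    "u \<in> labels k \<Longrightarrow> w \<in> wits L \<Longrightarrow> intro_vertex L u w \<in> fin_subsets L"
  and forget_vertex_in_fin_subsets:
    "u \<in> labels k \<Longrightarrow> w \<in> wits L \<Longrightarrow> forget_vertex L u w \<in> fin_subsets L"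
  and intro_edge_in_fin_subsets:
    "u \<in> labels k \<Longrightarrow> v \<in> labels k \<Longrightarrow> u \<noteq> v \<Longrightarrow> w \<in> wits L \<Longrightarrow>
      intro_edge L u v w \<in> fin_subsets L"
  and join_wits_in_fin_subsets:
    "w \<in> wits L \<Longrightarrow> w' \<in> wits L \<Longrightarrow> join_wits L w w' \<in> fin_subsets L"
  using wf_level unfolding wf_dp_level_def by blast+

lemma reachable_is_state:
  assumes "reachable k L (b, S)"
  shows "b \<subseteq> labels k" and "S \<in> fin_subsets L"
proof -
  have "b \<subseteq> labels k \<and> S \<in> fin_subsets L"
    using assms
  proof (induction rule: reachable_induct)
    case initial
    show ?case
      by (simp add: leaf_wits_in_fin_subsets)
  next
    case (intro_vertex b S u)
    then show ?case
      by (simp add: lift_transition_in_fin_subsets intro_vertex_in_fin_subsets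
          del: atLeastAtMost_iff)
  next
    case (forget_vertex b S u)
    then have "u \<in> labels k" "b - {u} \<subseteq> labels k"
      by blast+
    with forget_vertex show ?case
      by (simp add: lift_transition_in_fin_subsets forget_vertex_in_fin_subsets
          del: atLeastAtMost_iff)
  next
    case (intro_edge b S u v)
    then have "u \<in> labels k" "v \<in> labels k"
      by blast+
    with intro_edge show ?case
      by (simp add: lift_transition_in_fin_subsets intro_edge_in_fin_subsets
          del: atLeastAtMost_iff)
  next
    case (join b S S')
    then show ?case
      by (simp add: lift_transition2_in_fin_subsets join_wits_in_fin_subsets)
  qed
  then show "b \<subseteq> labels k" and "S \<in> fin_subsets L"
    by simp_all
qed

lemma reachable_bag_label:
  assumes "reachable k L (b, S)" and "u \<in> b"
  shows "u \<in> labels k"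
  using reachable_is_state(1)[OF assms(1)] assms(2) by blast

lemma reachable_wits:
  assumes "reachable k L (b, S)" and "w \<in> S"
  shows "w \<in> wits L"
  using reachable_is_state(2)[OF assms(1)] assms(2) by (rule fin_subsetsD)

lemma reachable_realized:
  assumes clean: "\<And>S. S \<in> fin_subsets L \<Longrightarrow> clean L S = S"
    and "reachable k L (b, S)"
  shows "\<exists>\<tau>. legal k \<tau> \<and> bag \<tau> = b \<and> dyn L \<tau> = S"
proof -
  have clean_reachable: "clean L S = S" if "reachable k L (b, S)" for b S
    by (rule clean[OF reachable_is_state(2)[OF that]])
  from assms(2) show ?thesis
  proof (induction rule: reachable_induct)
    case initial
    show ?case
      by (intro exI[of _ Leaf]) simp
  next
    case (intro_vertex b S u)
    then obtain \<tau> where "legal k \<tau>" "bag \<tau> = b" "dyn L \<tau> = S"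
      by blast
    then show ?case
      using intro_vertex.hyps clean_reachable[OF reachable.intro_vertex[OF intro_vertex.hyps]]
      by (intro exI[of _ "IntroVertex u \<tau>"]) simp
  next
    case (forget_vertex b S u)
    then obtain \<tau> where "legal k \<tau>" "bag \<tau> = b" "dyn L \<tau> = S"
      by blast
    then show ?case
      using forget_vertex.hyps(2) reachable_bag_label[OF forget_vertex.hyps]
        clean_reachable[OF reachable.forget_vertex[OF forget_vertex.hyps]]
      by (intro exI[of _ "ForgetVertex u \<tau>"]) simp
  next
    case (intro_edge b S u v)
    then obtain \<tau> where "legal k \<tau>" "bag \<tau> = b" "dyn L \<tau> = S"
      by blast
    then show ?case
      using intro_edge.hyps(2-4) reachable_bag_label[OF intro_edge.hyps(1)]
        clean_reachable[OF reachable.intro_edge[OF intro_edge.hyps]]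
      by (intro exI[of _ "IntroEdge u v \<tau>"]) simp
  next
    case (join b S S')
    then obtain \<sigma> \<tau> where "legal k \<sigma>" "bag \<sigma> = b" "dyn L \<sigma> = S"
      and "legal k \<tau>" "bag \<tau> = b" "dyn L \<tau> = S'"
      by blast
    then show ?case
      using clean_reachable[OF reachable.join[OF join.hyps]]
      by (intro exI[of _ "Join \<sigma> \<tau>"]) simp
  qed
qed

end

locale dp_core_level_action = dp_core_level +
  fixes lbl :: "witness \<Rightarrow> nat set" and \<rho> :: action
  assumes lbl_subset: "w \<in> wits L \<Longrightarrow> lbl w \<subseteq> labels k"
    and action: "witness_action k L lbl \<rho>"
    and initial_well_formed: "well_formed lbl (initial_state L)"
begin

lemma action_defined_iff:
  assumes "f \<in> relabelings k" and "w \<in> wits L"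
  shows "w \<in> dom (\<rho> f) \<longleftrightarrow> lbl w \<subseteq> dom f"
  using action assms unfolding witness_action_def by meson

lemma action_inverse:
  assumes "f \<in> relabelings k" and "w \<in> wits L" and "\<rho> f w = Some w'"
  shows "\<rho> (map_inv f) w' = Some w"
  using action assms unfolding witness_action_def by meson

lemma action_comp:
  assumes "f \<in> relabelings k" and "f' \<in> relabelings k" and "w \<in> wits L"
    and "\<rho> f' w = Some w'" and "\<rho> f w' = Some w''"
  shows "\<rho> (f \<circ>\<^sub>m f') w = Some w''"
  using action assms unfolding witness_action_def by meson

lemma action_mono:
  assumes "f \<in> relabelings k" and "f' \<in> relabelings k" and "w \<in> wits L"
    and "f \<subseteq>\<^sub>m f'" and "\<rho> f w = Some w'"
  shows "\<rho> f' w = Some w'"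
  using action assms unfolding witness_action_def by meson

lemma action_intro_vertex:
  assumes "f \<in> relabelings k" and "w \<in> wits L" and "\<rho> f w = Some w'" and "f u = Some u'"
    and "act_set \<rho> f (intro_vertex L u w) = Some T"
  shows "T = intro_vertex L u' w'"
  using action assms unfolding witness_action_def by meson

lemma action_forget_vertex:
  assumes "f \<in> relabelings k" and "w \<in> wits L" and "\<rho> f w = Some w'" and "f u = Some u'"
    and "act_set \<rho> f (forget_vertex L u w) = Some T"
  shows "T = forget_vertex L u' w'"
  using action assms unfolding witness_action_def by meson

lemma action_intro_edge:
  assumes "f \<in> relabelings k" and "w \<in> wits L" and "\<rho> f w = Some w'"
    and "u \<noteq> v" and "f u = Some u'" and "f v = Some v'"
    and "act_set \<rho> f (intro_edge L u v w) = Some T"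
  shows "T = intro_edge L u' v' w'"
  using action assms unfolding witness_action_def by meson

lemma action_join_wits:
  assumes "f \<in> relabelings k" and "w1 \<in> wits L" and "w2 \<in> wits L"
    and "\<rho> f w1 = Some w1'" and "\<rho> f w2 = Some w2'"
    and "act_set \<rho> f (join_wits L w1 w2) = Some T"
  shows "T = join_wits L w1' w2'"
  using action assms unfolding witness_action_def by meson

text \<open>The axioms do not say that the empty relabeling acts trivially; it does because it is both
  idempotent and its own inverse.\<close>

lemma action_empty:
  assumes "w \<in> wits L" and "lbl w = {}"
  shows "\<rho> Map.empty w = Some w"
proof -
  have empty: "Map.empty \<in> relabelings k"
    by (simp add: relabelings_def)
  then obtain w' where w': "\<rho> Map.empty w = Some w'"
    using action_defined_iff assms by blast
  have "map_inv Map.empty = (Map.empty :: nat \<rightharpoonup> nat)"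
    by (simp add: map_inv_def)
  then have "\<rho> Map.empty w' = Some w"
    using action_inverse[OF empty assms(1) w'] by simp
  then have "\<rho> (Map.empty \<circ>\<^sub>m (Map.empty :: nat \<rightharpoonup> nat)) w = Some w"
    by (rule action_comp[OF empty empty assms(1) w'])
  then show ?thesis
    by simp
qed

definition act :: "(nat \<Rightarrow> nat) \<Rightarrow> witness \<Rightarrow> witness" where
  "act p w = the (\<rho> (relabeling_of k p) w)"

context
  fixes p :: "nat \<Rightarrow> nat"
  assumes p: "p permutes labels k"
begin

lemmas relabeling_of_p = relabeling_of_in_relabelings[OF p]

lemma action_relabeling_of:
  assumes "w \<in> wits L"
  shows "\<rho> (relabeling_of k p) w = Some (act p w)"
  using action_defined_iff[OF relabeling_of_p assms] lbl_subset[OF assms]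
  by (auto simp: act_def dom_map_on)

lemma act_set_relabeling_of:
  assumes "S \<in> fin_subsets L"
  shows "act_set \<rho> (relabeling_of k p) S = Some (act p ` S)"
  using fin_subsetsD[OF assms] by (intro act_set_eq_image action_relabeling_of)

lemma act_lift_intro_vertex:
  assumes "u \<in> labels k" and "S \<in> fin_subsets L"
  shows "act p ` lift_transition (intro_vertex L u) S =
    lift_transition (intro_vertex L (p u)) (act p ` S)"
proof (rule image_lift_transition)
  fix w
  assume "w \<in> S"
  then have w: "w \<in> wits L"
    by (rule fin_subsetsD[OF assms(2)])
  show "act p ` intro_vertex L u w = intro_vertex L (p u) (act p w)"
    by (rule action_intro_vertex[OF relabeling_of_p w action_relabeling_of[OF w]
          map_on_apply[OF assms(1)]
          act_set_relabeling_of[OF intro_vertex_in_fin_subsets[OF assms(1) w]]])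
qed

lemma act_lift_forget_vertex:
  assumes "u \<in> labels k" and "S \<in> fin_subsets L"
  shows "act p ` lift_transition (forget_vertex L u) S =
    lift_transition (forget_vertex L (p u)) (act p ` S)"
proof (rule image_lift_transition)
  fix w
  assume "w \<in> S"
  then have w: "w \<in> wits L"
    by (rule fin_subsetsD[OF assms(2)])
  show "act p ` forget_vertex L u w = forget_vertex L (p u) (act p w)"
    by (rule action_forget_vertex[OF relabeling_of_p w action_relabeling_of[OF w]
          map_on_apply[OF assms(1)]
          act_set_relabeling_of[OF forget_vertex_in_fin_subsets[OF assms(1) w]]])
qed

lemma act_lift_intro_edge:
  assumes "u \<in> labels k" and "v \<in> labels k" and "u \<noteq> v" and "S \<in> fin_subsets L"
  shows "act p ` lift_transition (intro_edge L u v) S =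
    lift_transition (intro_edge L (p u) (p v)) (act p ` S)"
proof (rule image_lift_transition)
  fix w
  assume "w \<in> S"
  then have w: "w \<in> wits L"
    by (rule fin_subsetsD[OF assms(4)])
  show "act p ` intro_edge L u v w = intro_edge L (p u) (p v) (act p w)"
    by (rule action_intro_edge[OF relabeling_of_p w action_relabeling_of[OF w] assms(3)
          map_on_apply[OF assms(1)] map_on_apply[OF assms(2)]
          act_set_relabeling_of[OF intro_edge_in_fin_subsets[OF assms(1-3) w]]])
qed

lemma act_lift_join_wits:
  assumes "S \<in> fin_subsets L" and "S' \<in> fin_subsets L"
  shows "act p ` lift_transition2 (join_wits L) S S' =
    lift_transition2 (join_wits L) (act p ` S) (act p ` S')"
proof (rule image_lift_transition2)
  fix w w'
  assume "w \<in> S" "w' \<in> S'"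
  then have w: "w \<in> wits L" and w': "w' \<in> wits L"
    using assms fin_subsetsD by blast+
  show "act p ` join_wits L w w' = join_wits L (act p w) (act p w')"
    by (rule action_join_wits[OF relabeling_of_p w w' action_relabeling_of[OF w]
          action_relabeling_of[OF w'] act_set_relabeling_of[OF join_wits_in_fin_subsets[OF w w']]])
qed

lemma act_leaf_wits: "act p ` leaf_wits L = leaf_wits L"
proof -
  have "act p w = w" if "w \<in> leaf_wits L" for w
  proof -
    have w: "w \<in> wits L" "lbl w = {}"
      using that fin_subsetsD[OF leaf_wits_in_fin_subsets] initial_well_formed
      by (auto simp: well_formed_def initial_state_def)
    have "\<rho> (relabeling_of k p) w = Some w"
      by (rule action_mono[OF _ relabeling_of_p w(1) _ action_empty[OF w]])
        (simp_all add: relabelings_def)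
    then show ?thesis
      by (simp add: act_def)
  qed
  then show ?thesis
    by simp
qed

lemma reachable_permute:
  assumes "reachable k L (b, S)"
  shows "reachable k L (p ` b, act p ` S)"
  using assms
proof (induction rule: reachable_induct)
  case initial
  show ?case
    using reachable.initial by (simp add: act_leaf_wits)
next
  case (intro_vertex b S u)
  have "p u \<in> labels k" "p u \<notin> p ` b"
    using intro_vertex.hyps permutes_in_image[OF p] inj_image_mem_iff[OF permutes_inj[OF p]]
    by blast+
  then have "reachable k L (p ` b \<union> {p u}, lift_transition (intro_vertex L (p u)) (act p ` S))"
    by (rule reachable.intro_vertex[OF intro_vertex.IH])
  then show ?case
    using act_lift_intro_vertex[OF intro_vertex.hyps(2)
        reachable_is_state(2)[OF intro_vertex.hyps(1)]]
    by simp
next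
  case (forget_vertex b S u)
  have "reachable k L (p ` b - {p u}, lift_transition (forget_vertex L (p u)) (act p ` S))"
    by (rule reachable.forget_vertex[OF forget_vertex.IH imageI[OF forget_vertex.hyps(2)]])
  then show ?case
    using act_lift_forget_vertex[OF reachable_bag_label[OF forget_vertex.hyps]
        reachable_is_state(2)[OF forget_vertex.hyps(1)]]
    by (simp add: image_set_diff[OF permutes_inj[OF p]])
next
  case (intro_edge b S u v)
  have "p u \<in> p ` b" "p v \<in> p ` b" "p u \<noteq> p v"
    using intro_edge.hyps by (simp_all add: inj_eq[OF permutes_inj[OF p]])
  then have "reachable k L (p ` b, lift_transition (intro_edge L (p u) (p v)) (act p ` S))"
    by (rule reachable.intro_edge[OF intro_edge.IH])
  then show ?case
    using act_lift_intro_edge[OF _ _ intro_edge.hyps(4)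
        reachable_is_state(2)[OF intro_edge.hyps(1)]]
      reachable_bag_label[OF intro_edge.hyps(1)] intro_edge.hyps(2,3)
    by simp
next
  case (join b S S')
  have "reachable k L (p ` b, lift_transition2 (join_wits L) (act p ` S) (act p ` S'))"
    by (rule reachable.join[OF join.IH])
  then show ?case
    using act_lift_join_wits reachable_is_state(2) join.hyps by simp
qed

end

lemma reachable_relabels_to:
  assumes reach: "reachable k L s" and f: "f \<in> relabelings k" and "relabels_to \<rho> f s s'"
  shows "reachable k L s'"
proof -
  obtain b S b' S' where s: "s = (b, S)" and s': "s' = (b', S')"
    by (metis surj_pair)
  have b: "dom f = b" and b': "b' = map_image f b" and act_set: "act_set \<rho> f S = Some S'"
    using assms(3) by (simp_all add: relabels_to_def s s')
  obtain p where p: "p permutes labels k" and ext: "f \<subseteq>\<^sub>m relabeling_of k p"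
    using relabeling_extends_to_permutation[OF f] .
  have "f u = Some (p u)" if "u \<in> b" for u
  proof -
    have "u \<in> labels k"
      using that reachable_is_state(1) reach unfolding s by blast
    then show ?thesis
      using ext that by (simp add: map_le_def b map_on_apply)
  qed
  then have "b' = p ` b"
    unfolding b' by (rule map_image_eq_image)
  moreover have "\<rho> f w = Some (act p w)" if w_in: "w \<in> S" for w
  proof -
    have w: "w \<in> wits L"
      using reachable_wits[OF _ w_in] reach unfolding s by blast
    have "S \<subseteq> dom (\<rho> f)"
      using act_set by (simp add: act_set_def split: if_splits)
    then obtain w' where w': "\<rho> f w = Some w'"
      using w_in by blast
    then show ?thesis
      using action_mono[OF f relabeling_of_in_relabelings[OF p] w ext w'] by (simp add: act_def)
  qed
  then have "S' = act p ` S"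
    using act_set act_set_eq_image[of S \<rho> f "act p"] by simp
  ultimately show ?thesis
    using reachable_permute[OF p] reach by (simp add: s s')
qed

lemma reachable_refutation_step:
  assumes "refutation_step k L \<rho> Prev f s" and f: "f \<in> relabelings k"
    and Prev: "\<And>s. s \<in> Prev \<Longrightarrow> reachable k L s"
  shows "reachable k L s"
  using assms(1)
proof cases
  case (step_intro_vertex b S u)
  then show ?thesis
    by (blast intro: reachable_relabels_to[OF reachable.intro_vertex f] Prev)
next
  case (step_forget_vertex b S u)
  then show ?thesis
    by (blast intro: reachable_relabels_to[OF reachable.forget_vertex f] Prev)
next
  case (step_intro_edge b S u v)
  then show ?thesis
    by (blast intro: reachable_relabels_to[OF reachable.intro_edge f] Prev)
next
  case (step_join b S S' \<pi> S'')
  have "map_image \<pi> b = b"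
    using map_image_dom[of \<pi>] step_join(4,5) by simp
  then have "relabels_to \<rho> \<pi> (b, S') (b, S'')"
    using step_join(4,6) by (simp add: relabels_to_def)
  then have "reachable k L (b, S'')"
    by (rule reachable_relabels_to[OF Prev[OF step_join(2)] step_join(3)])
  then show ?thesis
    by (rule reachable_relabels_to[OF reachable.join[OF Prev[OF step_join(1)]] f step_join(7)])
qed

lemma reachable_relabeled_refutation:
  assumes F: "set F \<subseteq> relabelings k" and ref: "relabeled_refutation k L lbl \<rho> F ss"
    and "i \<le> length F"
  shows "reachable k L (ss ! i)"
  using assms(3)
proof (induction i rule: less_induct)
  case (less i)
  show ?case
  proof (cases "i = 0")
    case True
    then show ?thesis
      using ref reachable.initial by (simp add: relabeled_refutation_def initial_state_def)
  next
    case False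
    then have "refutation_step k L \<rho> {ss ! j | j. j < i} (F ! (i - 1)) (ss ! i)"
      using ref less.prems by (simp add: relabeled_refutation_def)
    moreover have "F ! (i - 1) \<in> relabelings k"
      using F less.prems False nth_mem[of "i - 1" F] by auto
    ultimately show ?thesis
      by (rule reachable_refutation_step) (use less in auto)
  qed
qed

end

lemma relabeled_refutation_initial_well_formed:
  assumes "relabeled_refutation k L lbl \<rho> F ss"
  shows "well_formed lbl (initial_state L)"
proof -
  have "ss ! 0 \<in> set ss"
    using assms by (intro nth_mem) (simp add: relabeled_refutation_def)
  then show ?thesis
    using assms by (auto simp: relabeled_refutation_def)
qed

lemma rejected_notin_graph_property:
  assumes "coherent D" and "\<tau> \<in> itds k" and "\<not> accepts (D k) \<tau>"
  shows "itd_graph \<tau> \<notin> graph_property D"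
  using assms unfolding coherent_def graph_property_def by blast

theorem theorem2:
  fixes k :: nat
    and F :: "(nat \<rightharpoonup> nat) list"
    and D :: "nat \<Rightarrow> dp_level"
    and Lbl :: "nat \<Rightarrow> witness \<Rightarrow> nat set"
    and \<rho> :: "nat \<Rightarrow> action"
  assumes "set F \<subseteq> relabelings k"
    and "dp_core D"
    and "coherent D"
    and "identity_cleaning D"
    and "witness_labelling D Lbl"
    and "\<forall>k'. witness_action k' (D k') (Lbl k') (\<rho> k')"
    and "\<exists>ss. relabeled_refutation k (D k) (Lbl k) (\<rho> k) F ss"
  shows "\<exists>\<tau>\<in>itds k. itd_graph \<tau> \<notin> graph_property D"
proof -
  obtain ss where ref: "relabeled_refutation k (D k) (Lbl k) (\<rho> k) F ss"
    using assms(7) by blast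
  interpret dp_core_level_action k "D k" "Lbl k" "\<rho> k"
    using assms(2,5,6) relabeled_refutation_initial_well_formed[OF ref]
    by unfold_locales (auto simp: dp_core_def witness_labelling_def simp del: atLeastAtMost_iff)
  obtain b S where last: "ss ! length F = (b, S)"
    by (rule prod.exhaust)
  have "reachable k (D k) (b, S)"
    using reachable_relabeled_refutation[OF assms(1) ref order_refl] by (simp add: last)
  moreover have "clean (D k) S = S" if "S \<in> fin_subsets (D k)" for S
    using assms(4) that by (simp add: identity_cleaning_def)
  ultimately obtain \<tau> where "legal k \<tau>" and "dyn (D k) \<tau> = S"
    using reachable_realized by blast
  then have "\<tau> \<in> itds k" and "\<not> accepts (D k) \<tau>"
    using ref by (simp_all add: itds_def relabeled_refutation_def inconsistent_def accepts_def last)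
  then show ?thesis
    using rejected_notin_graph_property[OF assms(3)] by blast
qed

end
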